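(* Let $X$ be a real normed linear space with dual $X^*$, let $C\subset X$ be a nonempty closed convex subset, and let $x^*\in\operatorname{bar}(C)$. Then the following statements are equivalent: (a) $x^*\in\operatorname{int}\operatorname{bar}(C)$; (b) there exists $\gamma>0$ such that $\displaystyle\sup_{c\in C\setminus B(0;\gamma)}\langle x^*,c\rangle<\sigma_C(x^* )$; (c) there exist positive numbers $\alpha,R$ such that $\langle x^*,c\rangle\le-\alpha\|c\|$ for all $c\in C\setminus B(0;R)$; (d) $\displaystyle\limsup_{c\in C;\ \|c\|\to\infty}\frac{\langle x^*,c\rangle}{\|c\|}<0$.
   Context: The support function of $C$ is $\sigma_C(x^* )=\sup\{\langle x^*,c\rangle: c\in C\}$ for $x^*\in X^*$, and the barrier cone of $C$ is $\operatorname{bar}(C)=\{x^*\in X^*: \sigma_C(x^* )<+\infty\}$. The interior $\operatorname{int}$ is taken in the norm topology of $X^*$. $B(0;\gamma)$ denotes the open ball of radius $\gamma$ around the origin in $X$. A supremum over the empty set is $-\infty$; in particular, if $C$ is bounded then the limsup in (d) is $-\infty$. *)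

theory Defs
  imports "HOL-Analysis.Analysis"
begin

text \<open>
  The norm dual of \<open>'a\<close> is the type \<open>'a \<Rightarrow>\<^sub>L real\<close> of bounded linear functionals with the operator
  norm. Suprema are taken in \<^typ>\<open>ereal\<close>, so that the supremum over the empty set is \<open>-\<infinity>\<close>.
\<close>

definition support_function :: "'a::real_normed_vector set \<Rightarrow> ('a \<Rightarrow>\<^sub>L real) \<Rightarrow> ereal" where
  "support_function C f = (SUP c\<in>C. ereal (blinfun_apply f c))"

definition barrier_cone :: "'a::real_normed_vector set \<Rightarrow> ('a \<Rightarrow>\<^sub>L real) set" where
  "barrier_cone C = {f. support_function C f < \<infinity>}"

text \<open>
  The filter of \<open>c \<in> C\<close> with \<open>\<parallel>c\<parallel> \<rightarrow> \<infinity>\<close>. It is \<^const>\<open>bot\<close> iff \<open>C\<close> is bounded, and in that case every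
  \<^const>\<open>Limsup\<close> along it is \<open>-\<infinity>\<close>.
\<close>

definition at_infinity_within :: "'a::real_normed_vector set \<Rightarrow> 'a filter" where
  "at_infinity_within C = inf at_infinity (principal C)"

end

theory Submission
  imports Defs
begin

text \<open>
  Only the step from (a) to (c) is not elementary. If \<open>f\<close> is interior to the barrier cone, the
  Baire category theorem in the complete space \<open>X\<^sup>*\<close> and the convexity of the support function
  bound \<open>\<sigma>\<^sub>C\<close> by some \<open>M\<close> on a ball of radius \<open>\<delta>\<close> around \<open>f\<close>; taking the supremum over
  that ball, \<open>f c + \<delta> \<parallel>c\<parallel> \<le> M\<close> on \<open>C\<close> by the Hahn--Banach theorem.
  For (b) to (c), choose \<open>c\<^sub>0 \<in> C\<close> with \<open>f c\<^sub>0\<close> above the supremum in (b); for a remote \<open>c \<in> C\<close>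
  the point of the segment from \<open>c\<^sub>0\<close> to \<open>c\<close> at distance \<open>2 \<gamma>\<close> from \<open>c\<^sub>0\<close> lies outside the ball, so
  \<open>f\<close> drops by a fixed amount over each length \<open>2 \<gamma>\<close> of the segment.
\<close>

section \<open>Sublinear functionals and the Hahn--Banach theorem\<close>

definition sublinear :: "('a::real_vector \<Rightarrow> real) \<Rightarrow> bool" where
  "sublinear p \<longleftrightarrow>
    (\<forall>x y. p (x + y) \<le> p x + p y) \<and> (\<forall>t x. 0 \<le> t \<longrightarrow> p (t *\<^sub>R x) = t * p x)"

lemma sublinear_add: "sublinear p \<Longrightarrow> p (x + y) \<le> p x + p y"
  by (simp add: sublinear_def)

lemma sublinear_scaleR: "sublinear p \<Longrightarrow> 0 \<le> t \<Longrightarrow> p (t *\<^sub>R x) = t * p x"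
  by (simp add: sublinear_def)

lemma sublinear_zero: "sublinear p \<Longrightarrow> p 0 = 0"
  using sublinear_scaleR[of p 0 0] by simp

lemma sublinear_minus: "sublinear p \<Longrightarrow> - p (- x) \<le> p x"
  using sublinear_add[of p x "- x"] sublinear_zero[of p] by simp

lemma sublinear_norm: "sublinear norm"
  by (simp add: sublinear_def norm_triangle_ineq)

text \<open>One inequality for positive scalars suffices: applied to \<open>1 / t\<close> and
  \<open>t *\<^sub>R x\<close> it yields the reverse one.\<close>

lemma sublinearI:
  assumes add: "\<And>x y. p (x + y) \<le> p x + p y"
    and zero: "p 0 = 0"
    and scale: "\<And>t x. 0 < t \<Longrightarrow> p (t *\<^sub>R x) \<le> t * p x"
  shows "sublinear p"
proof -
  have "p (t *\<^sub>R x) = t * p x" if "0 \<le> t" for t x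
  proof (cases "t = 0")
    case False
    with that have t: "0 < t" by simp
    have "p ((1 / t) *\<^sub>R (t *\<^sub>R x)) \<le> (1 / t) * p (t *\<^sub>R x)"
      using t by (intro scale) simp
    then have "t * p x \<le> p (t *\<^sub>R x)"
      using t by (simp add: field_simps)
    with scale[OF t, of x] show ?thesis by simp
  qed (simp add: zero)
  with add show ?thesis by (simp add: sublinear_def)
qed

text \<open>For sublinear \<open>p\<close> this is the largest sublinear functional below
  \<open>p\<close> whose value at \<open>- y\<close> is at most \<open>- p y\<close>.\<close>

definition sublinear_shift :: "('a::real_vector \<Rightarrow> real) \<Rightarrow> 'a \<Rightarrow> 'a \<Rightarrow> real" where
  "sublinear_shift p y x = (INF t\<in>{0..}. p (x + t *\<^sub>R y) - t * p y)"

lemma sublinear_shift_bdd_below: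
  assumes "sublinear p"
  shows "bdd_below ((\<lambda>t. p (x + t *\<^sub>R y) - t * p y) ` {0..})"
proof (rule bdd_belowI2)
  fix t :: real assume "t \<in> {0..}"
  then have "t * p y = p ((x + t *\<^sub>R y) + - x)"
    by (simp add: sublinear_scaleR[OF assms])
  also have "\<dots> \<le> p (x + t *\<^sub>R y) + p (- x)"
    by (rule sublinear_add[OF assms])
  finally show "- p (- x) \<le> p (x + t *\<^sub>R y) - t * p y" by simp
qed

lemma sublinear_shift_lower:
  assumes "sublinear p" "0 \<le> t"
  shows "sublinear_shift p y x \<le> p (x + t *\<^sub>R y) - t * p y"
  unfolding sublinear_shift_def
  using assms by (intro cINF_lower sublinear_shift_bdd_below) auto

lemma sublinear_shift_greatest:
  assumes "\<And>t. 0 \<le> t \<Longrightarrow> m \<le> p (x + t *\<^sub>R y) - t * p y"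
  shows "m \<le> sublinear_shift p y x"
  unfolding sublinear_shift_def using assms by (intro cINF_greatest) auto

lemma sublinear_shift_le:
  assumes "sublinear p"
  shows "sublinear_shift p y \<le> p"
  using sublinear_shift_lower[OF assms, of 0] by (simp add: le_fun_def)

text \<open>Parameters \<open>s\<close> for \<open>x\<close> and \<open>t\<close> for
  \<open>z\<close> combine to the parameter \<open>s + t\<close> for \<open>x + z\<close>;
  homogeneity is a rescaling of the parameter.\<close>

lemma sublinear_sublinear_shift:
  assumes p: "sublinear p"
  shows "sublinear (sublinear_shift p y)"
proof (rule sublinearI)
  fix x z
  have "sublinear_shift p y (x + z) - (p (z + t *\<^sub>R y) - t * p y) \<le> p (x + s *\<^sub>R y) - s * p y"
    if "0 \<le> s" "0 \<le> t" for s t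
    using sublinear_shift_lower[OF p, of "s + t" y "x + z"] that
      sublinear_add[OF p, of "x + s *\<^sub>R y" "z + t *\<^sub>R y"]
    by (simp add: algebra_simps)
  then have "sublinear_shift p y (x + z) - (p (z + t *\<^sub>R y) - t * p y) \<le> sublinear_shift p y x"
    if "0 \<le> t" for t
    using that by (intro sublinear_shift_greatest)
  then have "sublinear_shift p y (x + z) - sublinear_shift p y x \<le> p (z + t *\<^sub>R y) - t * p y"
    if "0 \<le> t" for t
    using that by (simp add: algebra_simps)
  then have "sublinear_shift p y (x + z) - sublinear_shift p y x \<le> sublinear_shift p y z"
    by (rule sublinear_shift_greatest)
  then show "sublinear_shift p y (x + z) \<le> sublinear_shift p y x + sublinear_shift p y z"
    by simp
next
  show "sublinear_shift p y 0 = 0"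
  proof (rule antisym)
    show "sublinear_shift p y 0 \<le> 0"
      using sublinear_shift_lower[OF p, of 0 y 0] sublinear_zero[OF p] by simp
    show "0 \<le> sublinear_shift p y 0"
      by (rule sublinear_shift_greatest) (simp add: sublinear_scaleR[OF p])
  qed
next
  fix t :: real and x assume t: "0 < t"
  have "sublinear_shift p y (t *\<^sub>R x) / t \<le> p (x + s *\<^sub>R y) - s * p y" if "0 \<le> s" for s
  proof -
    have "sublinear_shift p y (t *\<^sub>R x) \<le> p (t *\<^sub>R x + (t * s) *\<^sub>R y) - t * s * p y"
      using sublinear_shift_lower[OF p, of "t * s" y "t *\<^sub>R x"] t that by simp
    also have "p (t *\<^sub>R x + (t * s) *\<^sub>R y) = t * p (x + s *\<^sub>R y)"
      using sublinear_scaleR[OF p, of t "x + s *\<^sub>R y"] t by (simp add: scaleR_add_right)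
    finally show ?thesis
      using t by (simp add: field_simps)
  qed
  then have "sublinear_shift p y (t *\<^sub>R x) / t \<le> sublinear_shift p y x"
    by (rule sublinear_shift_greatest)
  then show "sublinear_shift p y (t *\<^sub>R x) \<le> t * sublinear_shift p y x"
    using t by (simp add: field_simps)
qed

text \<open>The pointwise infimum works: \<open>- q (- x)\<close> bounds every \<open>p x\<close>
  from below, so it is finite. Subadditivity involves two members of \<open>P\<close>, and the
  smaller of them can replace the other.\<close>

lemma sublinear_chain_Inf:
  assumes ne: "P \<noteq> {}"
    and sub: "\<And>p. p \<in> P \<Longrightarrow> sublinear p"
    and chain: "\<And>p r. p \<in> P \<Longrightarrow> r \<in> P \<Longrightarrow> p \<le> r \<or> r \<le> p"
    and bound: "\<And>p. p \<in> P \<Longrightarrow> p \<le> q"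
  obtains u where "sublinear u" "\<And>p. p \<in> P \<Longrightarrow> u \<le> p"
proof
  define u where "u = (\<lambda>x. INF p\<in>P. p x)"
  have bdd: "bdd_below ((\<lambda>p. p x) ` P)" for x
  proof (rule bdd_belowI2)
    fix p assume "p \<in> P"
    with bound sub have "p (- x) \<le> q (- x)" "- p (- x) \<le> p x"
      by (auto dest: le_funD intro: sublinear_minus)
    then show "- q (- x) \<le> p x" by linarith
  qed
  have lower: "u x \<le> p x" if "p \<in> P" for p x
    unfolding u_def using that bdd by (rule cINF_lower[rotated])
  have greatest: "m \<le> u x" if "\<And>p. p \<in> P \<Longrightarrow> m \<le> p x" for m x
    unfolding u_def using ne that by (rule cINF_greatest)
  show "u \<le> p" if "p \<in> P" for p
    using lower[OF that] by (simp add: le_fun_def)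
  show "sublinear u"
  proof (rule sublinearI)
    fix x y
    have "u (x + y) - r y \<le> p x" if "p \<in> P" "r \<in> P" for p r
    proof -
      from chain[OF that] show ?thesis
      proof
        assume "p \<le> r"
        then show ?thesis
          using lower[OF that(1), of "x + y"] sublinear_add[OF sub[OF that(1)], of x y]
          by (smt (verit) le_funD)
      next
        assume "r \<le> p"
        then show ?thesis
          using lower[OF that(2), of "x + y"] sublinear_add[OF sub[OF that(2)], of x y]
          by (smt (verit) le_funD)
      qed
    qed
    then have "u (x + y) - r y \<le> u x" if "r \<in> P" for r
      using that by (intro greatest)
    then have "u (x + y) - u x \<le> r y" if "r \<in> P" for r
      using that by (simp add: algebra_simps)
    then have "u (x + y) - u x \<le> u y"
      by (rule greatest)
    then show "u (x + y) \<le> u x + u y" by simp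
  next
    show "u 0 = 0"
      unfolding u_def using ne sub by (simp add: sublinear_zero cong: image_cong)
  next
    fix t :: real and x assume t: "0 < t"
    have "u (t *\<^sub>R x) / t \<le> p x" if "p \<in> P" for p
      using lower[OF that, of "t *\<^sub>R x"] sublinear_scaleR[OF sub[OF that], of t x] t
      by (simp add: field_simps)
    then have "u (t *\<^sub>R x) / t \<le> u x"
      by (rule greatest)
    then show "u (t *\<^sub>R x) \<le> t * u x"
      using t by (simp add: field_simps)
  qed
qed

text \<open>
  A minimal sublinear functional \<open>p\<close> equals each of its shifts, which turns the inequality
  \<open>sublinear_shift p y x \<le> p (x + y) - p y\<close> into superadditivity.
\<close>

theorem sublinear_dominates_linear:
  fixes q :: "'a::real_vector \<Rightarrow> real"
  assumes q: "sublinear q"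
  obtains p where "linear p" "p \<le> q"
proof -
  define A where "A = {p. sublinear p \<and> p \<le> q}"
  have "\<exists>m\<in>A. \<forall>p\<in>A. p \<le> m \<longrightarrow> p = m"
  \<comment> \<open>The order is reversed, so that a maximal element is a minimal sublinear
    functional below \<open>q\<close>.\<close>
  proof (rule predicate_Zorn)
    show "partial_order_on A (relation_of (\<lambda>p r. r \<le> p) A)"
      by (auto intro!: partial_order_on_relation_ofI)
  next
    fix P assume P: "P \<in> Chains (relation_of (\<lambda>p r. r \<le> p) A)"
    show "\<exists>u\<in>A. \<forall>p\<in>P. u \<le> p"
    proof (cases "P = {}")
      case True
      then show ?thesis using q by (auto simp: A_def)
    next
      case False
      have PA: "p \<in> A" and chain: "p \<le> r \<or> r \<le> p" if "p \<in> P" "r \<in> P" for p r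
        using P that by (auto simp: Chains_def relation_of_def)
      have P_sub: "sublinear p" and P_le: "p \<le> q" if "p \<in> P" for p
        using PA[OF that that] by (auto simp: A_def)
      obtain u where u: "sublinear u" "\<And>p. p \<in> P \<Longrightarrow> u \<le> p"
        using sublinear_chain_Inf[OF False P_sub chain P_le] by blast
      obtain r where "r \<in> P" using False by blast
      with u(2) P_le have "u \<le> q" by (blast intro: order_trans)
      with u show ?thesis by (auto simp: A_def)
    qed
  qed
  then obtain p where "p \<in> A" and minA: "\<forall>r\<in>A. r \<le> p \<longrightarrow> r = p" by blast
  then have p: "sublinear p" "p \<le> q" by (auto simp: A_def)
  have min: "r = p" if "sublinear r" "r \<le> p" for r
    using that minA order_trans[OF that(2) p(2)] by (simp add: A_def)
  have shift: "sublinear_shift p y = p" for y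
    using p by (intro min sublinear_sublinear_shift sublinear_shift_le)
  have add: "p (x + y) = p x + p y" for x y
    using sublinear_shift_lower[OF p(1), of 1 y x] sublinear_add[OF p(1), of x y]
    by (simp add: shift)
  have minus: "p (- x) = - p x" for x
    using add[of x "- x"] sublinear_zero[OF p(1)] by simp
  have "p (t *\<^sub>R x) = t * p x" for t x
  proof (cases "0 \<le> t")
    case False
    then show ?thesis
      using sublinear_scaleR[OF p(1), of "- t" x] minus[of "t *\<^sub>R x"] by simp
  qed (rule sublinear_scaleR[OF p(1)])
  with add have "linear p"
    by (intro linearI) auto
  with p(2) show thesis by (intro that)
qed

text \<open>A linear \<open>p\<close> below the shift of the norm along \<open>x\<close> satisfies
  \<open>p (- x) \<le> - norm x\<close>; with \<open>p \<le> norm\<close> this forces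
  \<open>p x = norm x\<close>.\<close>

corollary norming_functional:
  fixes x :: "'a::real_normed_vector"
  obtains g :: "'a \<Rightarrow>\<^sub>L real" where "norm g \<le> 1" "blinfun_apply g x = norm x"
proof -
  define q where "q = sublinear_shift norm x"
  obtain p where p: "linear p" "p \<le> q"
    using sublinear_dominates_linear sublinear_sublinear_shift[OF sublinear_norm]
    unfolding q_def by blast
  have "q \<le> norm"
    unfolding q_def by (rule sublinear_shift_le[OF sublinear_norm])
  with p(2) have "p \<le> norm" by (rule order_trans)
  then have le: "p y \<le> norm y" for y by (rule le_funD)
  have bound: "\<bar>p y\<bar> \<le> norm y" for y
    using le[of y] le[of "- y"] linear_neg[OF p(1), of y] by simp
  have bl: "bounded_linear p"
    using p(1) bound by (intro bounded_linear_intro[where K = 1]) (auto simp: linear_add linear_scale)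
  have "p (- x) \<le> - norm x"
    using le_funD[OF p(2), of "- x"] sublinear_shift_lower[OF sublinear_norm, of 1 x "- x"]
    by (simp add: q_def)
  then have "p x = norm x"
    using le[of x] linear_neg[OF p(1), of x] by simp
  then show thesis
    using bl bound
    by (intro that[of "Blinfun p"] norm_blinfun_bound)
      (auto simp: bounded_linear_Blinfun_apply)
qed

section \<open>The barrier cone\<close>

lemma barrier_cone_iff:
  "f \<in> barrier_cone C \<longleftrightarrow> (\<exists>M. \<forall>c\<in>C. blinfun_apply f c \<le> M)"
proof
  assume "f \<in> barrier_cone C"
  then obtain M where "support_function C f < ereal M"
    unfolding barrier_cone_def by (auto dest: less_PInf_Ex_of_nat[THEN iffD1])
  then have "blinfun_apply f c \<le> M" if "c \<in> C" for c
    using SUP_upper[OF that, of "\<lambda>c. ereal (blinfun_apply f c)"]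
    unfolding support_function_def by (metis ereal_less_eq(3) less_imp_le order_trans)
  then show "\<exists>M. \<forall>c\<in>C. blinfun_apply f c \<le> M" by blast
next
  assume "\<exists>M. \<forall>c\<in>C. blinfun_apply f c \<le> M"
  then obtain M where "\<forall>c\<in>C. blinfun_apply f c \<le> M" by blast
  then have "support_function C f \<le> ereal M"
    unfolding support_function_def by (intro SUP_least) simp
  then show "f \<in> barrier_cone C"
    by (auto simp: barrier_cone_def)
qed

section \<open>Uniform bounds near interior points, by Baire category\<close>

lemma locally_uniform_bound_of_interior_barrier_cone:
  fixes f :: "'a::real_normed_vector \<Rightarrow>\<^sub>L real"
  assumes f: "f \<in> interior (barrier_cone C)"
  obtains \<delta> M where "0 < \<delta>"
    "\<And>g c. norm g < \<delta> \<Longrightarrow> c \<in> C \<Longrightarrow> blinfun_apply (f + g) c \<le> M"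
proof -
  obtain e where e: "0 < e" "cball f e \<subseteq> barrier_cone C"
    using f by (auto simp: mem_interior_cball)
  \<comment> \<open>The closed sublevel sets of the support function cover the ball, and the dual is
    complete even if \<open>'a\<close> is not; hence some \<open>T n\<close> has an interior
    point.\<close>
  define T where "T n = cball f e \<inter> (\<Inter>c\<in>C. {g. blinfun_apply g c \<le> real n})" for n :: nat
  have closed: "closed (T n)" for n
    unfolding T_def by (intro closed_Int closed_INT ballI closed_Collect_le closed_cball continuous_intros)
  have cover: "\<Union>(range T) = cball f e"
  proof
    show "cball f e \<subseteq> \<Union>(range T)"
    proof
      fix g assume g: "g \<in> cball f e"
      with e(2) have "g \<in> barrier_cone C" by blast
      then obtain M where M: "\<forall>c\<in>C. blinfun_apply g c \<le> M"
        by (auto simp: barrier_cone_iff)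
      obtain n where "M \<le> real n" using real_arch_simple by blast
      with M g have "g \<in> T n" by (force simp: T_def)
      then show "g \<in> \<Union>(range T)" by blast
    qed
  qed (auto simp: T_def)
  have "\<exists>n. interior (T n) \<noteq> {}"
  proof (rule ccontr)
    assume "\<not> (\<exists>n. interior (T n) \<noteq> {})"
    then have "interior (\<Union>(range T)) = {}"
      using Baire_category_alt[of "euclidean :: ('a \<Rightarrow>\<^sub>L real) topology" "range T"] closed
        completely_metrizable_space_euclidean
      by auto
    then show False
      using e(1) centre_in_ball[of f e] ball_subset_cball[of f e] interior_maximal[OF ball_subset_cball[of f e] open_ball]
      unfolding cover by auto
  qed
  then obtain n g0 r where r: "0 < r" "ball g0 r \<subseteq> T n"
    by (auto simp: mem_interior)
  \<comment> \<open>\<open>f\<close> lies strictly between \<open>g0\<close> and a point \<open>h\<close> of the ball, so by convexity the bound near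
    \<open>g0\<close> carries over to a neighbourhood of \<open>f\<close>.\<close>
  define l where "l = e / (norm (f - g0) + 1)"
  have l: "0 < l"
    using e(1) by (simp add: l_def add_nonneg_pos)
  define h where "h = f + l *\<^sub>R (f - g0)"
  \<comment> \<open>The summand \<open>1\<close> in \<open>l\<close> avoids a division by zero when
    \<open>g0 = f\<close>; the point \<open>h\<close> still stays within distance \<open>e\<close>
    of \<open>f\<close>.\<close>
  have "l * (norm (f - g0) + 1) = e"
    using add_nonneg_pos[OF norm_ge_zero[of "f - g0"] zero_less_one] by (simp add: l_def)
  then have "l * norm (f - g0) \<le> e"
    using l by (simp add: distrib_left)
  then have "h \<in> cball f e"
    using l by (simp add: h_def dist_norm)
  with e(2) have "h \<in> barrier_cone C" by blast
  then obtain M where M: "\<forall>c\<in>C. blinfun_apply h c \<le> M"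
    by (auto simp: barrier_cone_iff)
  show thesis
  proof
    show "0 < l / (1 + l) * r" using l r(1) by simp
    fix g :: "'a \<Rightarrow>\<^sub>L real" and c
    assume g: "norm g < l / (1 + l) * r" and c: "c \<in> C"
    \<comment> \<open>The scaling makes \<open>f + g\<close> the convex combination of
      \<open>h\<close> and \<open>g0 + u\<close> with weights \<open>1 / (1 + l)\<close> and
      \<open>l / (1 + l)\<close>.\<close>
    define u where "u = ((1 + l) / l) *\<^sub>R g"
    have "norm u < r" using g l by (simp add: u_def field_simps)
    then have "g0 + u \<in> ball g0 r" by (simp add: dist_norm)
    with r(2) c have gu: "blinfun_apply (g0 + u) c \<le> real n"
      by (auto simp: T_def)
    have "l *\<^sub>R u = (1 + l) *\<^sub>R g"
      using l by (simp add: u_def)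
    then have "(1 + l) *\<^sub>R (f + g) = h + l *\<^sub>R (g0 + u)"
      by (simp add: h_def algebra_simps)
    then have "blinfun_apply ((1 + l) *\<^sub>R (f + g)) c = blinfun_apply (h + l *\<^sub>R (g0 + u)) c"
      by simp
    then have "(1 + l) * blinfun_apply (f + g) c = blinfun_apply h c + l * blinfun_apply (g0 + u) c"
      by (simp add: blinfun.add_left blinfun.scaleR_left)
    also have "\<dots> \<le> M + l * real n"
      using M c gu l by (intro add_mono mult_left_mono) auto
    finally show "blinfun_apply (f + g) c \<le> (M + l * real n) / (1 + l)"
      using l by (simp add: field_simps)
  qed
qed

section \<open>Interior points and linear decay\<close>

lemma interior_barrier_cone_imp_linear_decay:
  fixes f :: "'a::real_normed_vector \<Rightarrow>\<^sub>L real"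
  assumes "f \<in> interior (barrier_cone C)"
  shows "\<exists>\<alpha>>0. \<exists>R>0. \<forall>x\<in>C - ball 0 R. blinfun_apply f x \<le> - \<alpha> * norm x"
proof -
  obtain \<delta> M where \<delta>: "0 < \<delta>"
    and M: "\<And>g c. norm g < \<delta> \<Longrightarrow> c \<in> C \<Longrightarrow> blinfun_apply (f + g) c \<le> M"
    using locally_uniform_bound_of_interior_barrier_cone[OF assms] by blast
  have decay: "blinfun_apply f c + \<delta> / 2 * norm c \<le> M" if c: "c \<in> C" for c
  proof -
    obtain g :: "'a \<Rightarrow>\<^sub>L real" where g: "norm g \<le> 1" "blinfun_apply g c = norm c"
      by (rule norming_functional)
    \<comment> \<open>Half of the radius is used because the bound \<open>M\<close> is available
      only for \<open>norm g < \<delta>\<close>, while a norming functional may have norm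
      \<open>1\<close>.\<close>
    have "norm ((\<delta> / 2) *\<^sub>R g) \<le> \<delta> / 2 * 1"
      using \<delta> g(1) by simp
    then have "norm ((\<delta> / 2) *\<^sub>R g) < \<delta>"
      using \<delta> by simp
    from M[OF this c] show ?thesis
      by (simp add: blinfun.add_left blinfun.scaleR_left g(2))
  qed
  show ?thesis
  proof (intro exI conjI ballI)
    \<comment> \<open>Half of the slope \<open>\<delta> / 2\<close> absorbs \<open>M\<close> once
      \<open>norm x\<close> reaches \<open>4 * M / \<delta>\<close>; the \<open>1\<close> keeps the
      radius positive.\<close>
    show "0 < \<delta> / 4" "0 < max 1 (4 * M / \<delta>)" using \<delta> by auto
    fix x assume x: "x \<in> C - ball 0 (max 1 (4 * M / \<delta>))"
    then have "4 * M / \<delta> \<le> norm x" by auto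
    then have "M \<le> \<delta> / 4 * norm x" using \<delta> by (simp add: field_simps)
    with decay[of x] x show "blinfun_apply f x \<le> - (\<delta> / 4) * norm x" by simp
  qed
qed

text \<open>A perturbation of norm at most \<open>\<alpha>\<close> adds at most
  \<open>\<alpha> * norm c\<close>, which the decay compensates outside the ball; inside it every
  functional is bounded.\<close>

lemma linear_decay_imp_interior_barrier_cone:
  assumes "0 < \<alpha>" "\<forall>x\<in>C - ball 0 R. blinfun_apply f x \<le> - \<alpha> * norm x"
  shows "f \<in> interior (barrier_cone C)"
proof -
  have "ball f \<alpha> \<subseteq> barrier_cone C"
  proof
    fix g assume "g \<in> ball f \<alpha>"
    then have g: "norm (g - f) \<le> \<alpha>" by (simp add: dist_norm norm_minus_commute)
    \<comment> \<open>The sign of \<open>R\<close> is arbitrary here; the absolute value gives a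
      nonnegative bound that serves both cases.\<close>
    have "blinfun_apply g c \<le> norm g * \<bar>R\<bar>" if c: "c \<in> C" for c
    proof (cases "c \<in> ball 0 R")
      case True
      have "blinfun_apply g c \<le> norm g * norm c"
        using norm_blinfun[of g c] by simp
      also have "\<dots> \<le> norm g * \<bar>R\<bar>"
        using True by (intro mult_left_mono) auto
      finally show ?thesis .
    next
      case False
      have "blinfun_apply g c = blinfun_apply f c + blinfun_apply (g - f) c"
        by (simp add: blinfun.diff_left)
      also have "\<dots> \<le> - \<alpha> * norm c + norm (g - f) * norm c"
        using assms(2) c False norm_blinfun[of "g - f" c] by (intro add_mono) auto
      also have "\<dots> \<le> 0"
        using mult_right_mono[OF g norm_ge_zero[of c]] by simp
      also have "\<dots> \<le> norm g * \<bar>R\<bar>" by simp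
      finally show ?thesis .
    qed
    then show "g \<in> barrier_cone C" by (auto simp: barrier_cone_iff)
  qed
  with assms(1) show ?thesis by (auto simp: mem_interior)
qed

section \<open>The supremum gap and linear decay\<close>

lemma linear_decay_imp_SUP_less_support_function:
  assumes C: "c0 \<in> C" and \<alpha>: "0 < \<alpha>"
    and decay: "\<forall>x\<in>C - ball 0 R. blinfun_apply f x \<le> - \<alpha> * norm x"
  shows "\<exists>\<gamma>>0. (SUP c\<in>C - ball 0 \<gamma>. ereal (blinfun_apply f c)) < support_function C f"
proof (intro exI conjI)
  \<comment> \<open>Beyond this radius the decay pushes \<open>f\<close> below
    \<open>f c0 - 1\<close>. The margin \<open>1\<close> keeps the inequality strict after taking
    the supremum, also when that runs over the empty set.\<close>
  define \<gamma> where "\<gamma> = max (max 1 R) ((1 - blinfun_apply f c0) / \<alpha>)"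
  show "0 < \<gamma>" by (simp add: \<gamma>_def)
  have "blinfun_apply f c \<le> blinfun_apply f c0 - 1" if c: "c \<in> C - ball 0 \<gamma>" for c
  proof -
    have "R \<le> norm c" "(1 - blinfun_apply f c0) / \<alpha> \<le> norm c"
      using c by (auto simp: \<gamma>_def)
    with c decay \<alpha> have "blinfun_apply f c \<le> - \<alpha> * norm c"
      and "1 - blinfun_apply f c0 \<le> \<alpha> * norm c"
      by (auto simp: field_simps)
    then show ?thesis by simp
  qed
  then have "(SUP c\<in>C - ball 0 \<gamma>. ereal (blinfun_apply f c)) \<le> ereal (blinfun_apply f c0 - 1)"
    by (intro SUP_least) simp
  also have "\<dots> < ereal (blinfun_apply f c0)" by simp
  also have "\<dots> \<le> support_function C f"
    unfolding support_function_def using C by (rule SUP_upper)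
  finally show "(SUP c\<in>C - ball 0 \<gamma>. ereal (blinfun_apply f c)) < support_function C f" .
qed

lemma SUP_less_support_function_imp_linear_decay:
  assumes conv: "convex C" and \<gamma>: "0 < \<gamma>"
    and less: "(SUP c\<in>C - ball 0 \<gamma>. ereal (blinfun_apply f c)) < support_function C f"
  shows "\<exists>\<alpha>>0. \<exists>R>0. \<forall>x\<in>C - ball 0 R. blinfun_apply f x \<le> - \<alpha> * norm x"
proof -
  \<comment> \<open>A real \<open>s\<close> in between works even if the left side is
    \<open>-\<infinity>\<close> or the right side is \<open>\<infinity>\<close>.\<close>
  obtain s where s: "(SUP c\<in>C - ball 0 \<gamma>. ereal (blinfun_apply f c)) < ereal s"
    "ereal s < support_function C f"
    using ereal_dense2[OF less] by blast
  have far: "blinfun_apply f c \<le> s" if "c \<in> C" "\<gamma> \<le> norm c" for c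
  proof -
    have "ereal (blinfun_apply f c) \<le> (SUP c\<in>C - ball 0 \<gamma>. ereal (blinfun_apply f c))"
      using that by (intro SUP_upper) auto
    also note s(1)
    finally show ?thesis by simp
  qed
  obtain c0 where c0: "c0 \<in> C" "s < blinfun_apply f c0"
    using s(2) by (auto simp: support_function_def less_SUP_iff)
  have c0\<gamma>: "norm c0 < \<gamma>" using far[OF c0(1)] c0(2) by force
  \<comment> \<open>This is the mean rate at which \<open>f\<close> drops from \<open>f c0\<close>
    to \<open>s\<close> over the length \<open>2 * \<gamma>\<close>.\<close>
  define k where "k = (blinfun_apply f c0 - s) / (2 * \<gamma>)"
  have k: "0 < k" using c0 \<gamma> by (simp add: k_def)
  have slope: "blinfun_apply f c \<le> blinfun_apply f c0 - k * norm (c - c0)"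
    if c: "c \<in> C" "3 * \<gamma> \<le> norm c" for c
  proof -
    \<comment> \<open>Since \<open>norm c0 < \<gamma>\<close>, the threshold
      \<open>3 * \<gamma>\<close> puts \<open>c\<close> at distance at least
      \<open>2 * \<gamma>\<close> from \<open>c0\<close>, so that \<open>t \<le> 1\<close> and
      \<open>z\<close> lies on the segment.\<close>
    have n: "2 * \<gamma> \<le> norm (c - c0)"
      using norm_triangle_ineq2[of c c0] c(2) c0\<gamma> by simp
    define t where "t = 2 * \<gamma> / norm (c - c0)"
    have t: "0 < t" "t \<le> 1" "t * norm (c - c0) = 2 * \<gamma>"
      using n \<gamma> less_le_trans[of 0 "2 * \<gamma>" "norm (c - c0)"] by (simp_all add: t_def)
    define z where "z = c0 + t *\<^sub>R (c - c0)"
    have "z = (1 - t) *\<^sub>R c0 + t *\<^sub>R c"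
      by (simp add: z_def algebra_simps)
    with conv c0(1) c(1) t have zC: "z \<in> C"
      by (simp add: convexD)
    have "norm (t *\<^sub>R (c - c0)) = 2 * \<gamma>" using t by simp
    then have "\<gamma> \<le> norm z"
      using norm_triangle_ineq4[of z c0] c0\<gamma> by (simp add: z_def)
    from far[OF zC this] have "t * (blinfun_apply f c - blinfun_apply f c0) \<le> s - blinfun_apply f c0"
      by (simp add: z_def blinfun.add_right blinfun.scaleR_right blinfun.diff_right)
    also have "\<dots> = - t * (k * norm (c - c0))"
      using t(3) \<gamma> by (simp add: k_def field_simps)
    finally have "t * (blinfun_apply f c - blinfun_apply f c0) \<le> t * (- k * norm (c - c0))"
      by simp
    then have "blinfun_apply f c - blinfun_apply f c0 \<le> - k * norm (c - c0)"
      using t(1) by (rule mult_left_le_imp_le)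
    then show ?thesis by simp
  qed
  \<comment> \<open>By \<open>slope\<close>, \<open>f c\<close> is at most
    \<open>f c0 + k * \<gamma> - k * norm c\<close>; beyond \<open>R\<close> the constant part is at
    most half of \<open>k * norm c\<close>.\<close>
  define R where "R = max (3 * \<gamma>) (2 * (blinfun_apply f c0 + k * \<gamma>) / k)"
  show ?thesis
  proof (intro exI conjI ballI)
    show "0 < k / 2" "0 < R" using k \<gamma> by (auto simp: R_def)
    fix c assume "c \<in> C - ball 0 R"
    then have c: "c \<in> C" "3 * \<gamma> \<le> norm c" "2 * (blinfun_apply f c0 + k * \<gamma>) / k \<le> norm c"
      by (auto simp: R_def)
    have "k * (norm c - \<gamma>) \<le> k * norm (c - c0)"
      using norm_triangle_ineq2[of c c0] c0\<gamma> k by (intro mult_left_mono) auto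
    moreover have "blinfun_apply f c0 + k * \<gamma> \<le> k / 2 * norm c"
      using c(3) k by (simp add: field_simps)
    ultimately show "blinfun_apply f c \<le> - (k / 2) * norm c"
      using slope[OF c(1,2)] by (simp add: algebra_simps)
  qed
qed

text \<open>Dividing by the norm turns decay into an eventual bound on the quotient; conversely, a
  real number between the \<open>Limsup\<close> and \<open>0\<close> supplies
  \<open>- \<alpha>\<close>.\<close>

lemma linear_decay_iff_Limsup_less:
  "(\<exists>\<alpha>>0. \<exists>R>0. \<forall>x\<in>C - ball 0 R. blinfun_apply f x \<le> - \<alpha> * norm x) \<longleftrightarrow>
    Limsup (at_infinity_within C) (\<lambda>c. ereal (blinfun_apply f c / norm c)) < 0"
    (is "?decay \<longleftrightarrow> ?L < 0")
proof
  assume ?decay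
  then obtain \<alpha> R where \<alpha>: "0 < \<alpha>" and R: "0 < R"
    and decay: "\<forall>x\<in>C - ball 0 R. blinfun_apply f x \<le> - \<alpha> * norm x" by blast
  have "\<forall>\<^sub>F c in at_infinity_within C. ereal (blinfun_apply f c / norm c) \<le> ereal (- \<alpha>)"
    unfolding at_infinity_within_def eventually_inf_principal eventually_at_infinity
  proof (intro exI[of _ R] allI impI)
    fix x assume "R \<le> norm x" "x \<in> C"
    moreover from this R have "0 < norm x" by linarith
    ultimately show "ereal (blinfun_apply f x / norm x) \<le> ereal (- \<alpha>)"
      using decay by (simp add: field_simps)
  qed
  then have "?L \<le> ereal (- \<alpha>)" by (rule Limsup_bounded)
  also have "\<dots> < 0" using \<alpha> by simp
  finally show "?L < 0" .
next
  assume "?L < 0"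
  then obtain a where a: "?L < ereal a" "ereal a < 0"
    using ereal_dense2 by blast
  from Limsup_lessD[OF a(1)] obtain r
    where r: "\<And>x. r \<le> norm x \<Longrightarrow> x \<in> C \<Longrightarrow> blinfun_apply f x / norm x < a"
    unfolding at_infinity_within_def eventually_inf_principal eventually_at_infinity by auto
  show ?decay
  proof (intro exI conjI ballI)
    \<comment> \<open>The \<open>1\<close> also keeps \<open>x\<close> away from the origin, where
      the quotient is \<open>0\<close> by convention.\<close>
    show "0 < - a" "0 < max 1 r" using a(2) by auto
    fix x assume "x \<in> C - ball 0 (max 1 r)"
    then have "x \<in> C" "r \<le> norm x" "1 \<le> norm x" by auto
    moreover from this have "0 < norm x" by linarith
    ultimately show "blinfun_apply f x \<le> - (- a) * norm x"
      using r[of x] by (simp add: field_simps)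
  qed
qed

theorem theorem7:
  fixes C :: "'a::real_normed_vector set" and f :: "'a \<Rightarrow>\<^sub>L real"
  assumes "C \<noteq> {}" and "closed C" and "convex C"
    and "f \<in> barrier_cone C"
  defines "a \<equiv> f \<in> interior (barrier_cone C)"
    and "b \<equiv> (\<exists>\<gamma>>0. (SUP c\<in>C - ball 0 \<gamma>. ereal (blinfun_apply f c)) < support_function C f)"
    and "c \<equiv> (\<exists>\<alpha>>0. \<exists>R>0. \<forall>x\<in>C - ball 0 R. blinfun_apply f x \<le> - \<alpha> * norm x)"
    and "d \<equiv> Limsup (at_infinity_within C) (\<lambda>c. ereal (blinfun_apply f c / norm c)) < 0"
  shows "(a \<longleftrightarrow> b) \<and> (b \<longleftrightarrow> c) \<and> (c \<longleftrightarrow> d)"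
proof -
  \<comment> \<open>Linear decay, condition \<open>c\<close>, is the hub to which each of the other
    conditions is compared.\<close>
  have "a \<longleftrightarrow> c"
    unfolding a_def c_def
    using interior_barrier_cone_imp_linear_decay linear_decay_imp_interior_barrier_cone by blast
  moreover have "b \<longleftrightarrow> c"
    unfolding b_def c_def
    using SUP_less_support_function_imp_linear_decay[OF assms(3)]
      linear_decay_imp_SUP_less_support_function assms(1) by blast
  moreover have "c \<longleftrightarrow> d"
    unfolding c_def d_def by (rule linear_decay_iff_Limsup_less)
  ultimately show ?thesis by blast
qed

end
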